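(* Let the noise be independent Gaussian, $e_k\sim N(0,s^2)$, and run the method $x_{k+1}=x_k-h_k(g_k+e_k)$, $k=0,\dots,N-1$, with the constant schedule $h_k\equiv h/\sqrt{N+1}$ and uniform averaging $x_A=\frac1{N+1}\sum_{k=0}^Nx_k$, where the scaling $h>0$ is fixed. Then $$\mathcal E_N\;\le\;\frac{4\varepsilon\sqrt{N+1}}{h\,s^2}\,\big(1+o(1)\big)$$ as $N\to\infty$ at fixed $\varepsilon$ and $s$ (and fixed $h,R,L$).
   Context: Let $x_0\in\mathbb R$, $R,L,s>0$ and $\varepsilon\in(0,RL)$. Let $\mathcal C=\mathcal C(R,L)$ be the class of convex (possibly nonsmooth) functions $f:\mathbb R\to\mathbb R$ admitting a minimizer $x_\star$ with $|x_0-x_\star|\le R$ and all of whose subgradients at all points are bounded by $L$ in absolute value; write $f_\star=f(x_\star)$. For an instance $f$ the oracle uses a measurable selection $x\mapsto g(x)\in\partial f(x)$, and $g_k=g(x_k)$. The noise variables $e_0,\dots,e_{N-1}$ are i.i.d. $N(0,s^2)$, and $$\mathcal E_N=-\log\,\sup_f\ \mathbb P\big(f(x_A)-f_\star\ge\varepsilon\big),$$ the supremum running over all $f\in\mathcal C$ together with all measurable subgradient selections of the oracle. *)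

theory Defs
  imports "HOL-Probability.Probability" "HOL-Library.Landau_Symbols"
begin

definition subdifferential :: "(real \<Rightarrow> real) \<Rightarrow> real \<Rightarrow> real set" where
  "subdifferential f x = {v. \<forall>y. f y \<ge> f x + v * (y - x)}"

abbreviation is_minimizer :: "(real \<Rightarrow> real) \<Rightarrow> real \<Rightarrow> bool" where
  "is_minimizer f xs \<equiv> is_arg_min f (\<lambda>_. True) xs"

definition convex_class :: "real \<Rightarrow> real \<Rightarrow> real \<Rightarrow> (real \<Rightarrow> real) set" where
  "convex_class x0 R L = {f. convex_on UNIV f \<and>
     (\<exists>xs. is_minimizer f xs \<and> \<bar>x0 - xs\<bar> \<le> R) \<and>
     (\<forall>x. \<forall>v\<in>subdifferential f x. \<bar>v\<bar> \<le> L)}"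

definition subgradient_selection :: "(real \<Rightarrow> real) \<Rightarrow> (real \<Rightarrow> real) \<Rightarrow> bool" where
  "subgradient_selection f g \<longleftrightarrow>
     g \<in> borel_measurable borel \<and> (\<forall>x. g x \<in> subdifferential f x)"

primrec iterate ::
  "(nat \<Rightarrow> real) \<Rightarrow> (real \<Rightarrow> real) \<Rightarrow> real \<Rightarrow> (nat \<Rightarrow> real) \<Rightarrow> nat \<Rightarrow> real" where
  "iterate hs g x0 e 0 = x0"
| "iterate hs g x0 e (Suc k) =
     iterate hs g x0 e k - hs k * (g (iterate hs g x0 e k) + e k)"

definition averaged_iterate ::
  "nat \<Rightarrow> (nat \<Rightarrow> real) \<Rightarrow> (real \<Rightarrow> real) \<Rightarrow> real \<Rightarrow> (nat \<Rightarrow> real) \<Rightarrow> real" where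
  "averaged_iterate N hs g x0 e = (1 / real (N + 1)) * (\<Sum>k=0..N. iterate hs g x0 e k)"

definition constant_schedule :: "real \<Rightarrow> nat \<Rightarrow> nat \<Rightarrow> real" where
  "constant_schedule h N k = h / sqrt (real (N + 1))"

definition iid_gaussian :: "'a measure \<Rightarrow> nat \<Rightarrow> real \<Rightarrow> (nat \<Rightarrow> 'a \<Rightarrow> real) \<Rightarrow> bool" where
  "iid_gaussian M N s e \<longleftrightarrow> prob_space M \<and>
     prob_space.indep_vars M (\<lambda>_. borel) e {..<N} \<and>
     (\<forall>k<N. distributed M lborel (e k) (\<lambda>x. ennreal (normal_density 0 s x)))"

text \<open>In the set below, \<open>xs\<close> ranges over the minimizers of \<open>f\<close>; the value \<open>f xs\<close> does not
  depend on which one is taken.\<close>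

definition failure_probs ::
  "'a measure \<Rightarrow> (nat \<Rightarrow> 'a \<Rightarrow> real) \<Rightarrow> nat \<Rightarrow> (nat \<Rightarrow> real) \<Rightarrow>
   real \<Rightarrow> real \<Rightarrow> real \<Rightarrow> real \<Rightarrow> real set" where
  "failure_probs M e N hs x0 R L eps =
     {measure M {\<omega> \<in> space M. f (averaged_iterate N hs g x0 (\<lambda>k. e k \<omega>)) - f xs \<ge> eps} | f g xs.
        f \<in> convex_class x0 R L \<and> is_minimizer f xs \<and> subgradient_selection f g}"

text \<open>Since \<open>ln 0 = 0\<close> on the reals, the value \<open>\<infinity>\<close> at \<open>0\<close> is set explicitly.\<close>

definition neg_log :: "real \<Rightarrow> ereal" where
  "neg_log p = (if p = 0 then \<infinity> else ereal (- ln p))"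

definition error_exponent ::
  "'a measure \<Rightarrow> (nat \<Rightarrow> 'a \<Rightarrow> real) \<Rightarrow> nat \<Rightarrow> (nat \<Rightarrow> real) \<Rightarrow>
   real \<Rightarrow> real \<Rightarrow> real \<Rightarrow> real \<Rightarrow> ereal" where
  "error_exponent M e N hs x0 R L eps = neg_log (Sup (failure_probs M e N hs x0 R L eps))"

end

theory Submission
  imports Defs "HOL-Real_Asymp.Real_Asymp"
begin

text \<open>Take the slowly sloping instance \<open>f x = a * \<bar>x - x0\<bar>\<close>, started at its minimizer, with
  \<open>a\<close> of order \<open>(N + 1) powr (- 1/4)\<close>. Its subgradients are at most \<open>a\<close>, so every trajectory
  dominates the one with constant subgradient \<open>a\<close>, whose average is an affine function of the noise
  with weights \<open>N - j\<close>. Failure is therefore implied by a single Gaussian variable exceeding a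
  threshold, and optimizing \<open>a\<close> makes the exponent asymptotically
  \<open>3 * eps * sqrt (N + 1) / (h * s\<^sup>2)\<close>. The gap between 3 and 4 absorbs all lower-order terms, so
  \<open>\<delta> = 0\<close> works.\<close>

section \<open>Lower bound on a Gaussian tail\<close>

text \<open>Integrate the density over \<open>{t..t + \<sigma>}\<close> only: there it is at least
  its value \<open>?c\<close> at the right end, and the length \<open>\<sigma>\<close> cancels the
  normalizing factor. Compared with \<open>t\<^sup>2 / (2 * \<sigma>\<^sup>2)\<close>, the exponent
  loses only terms linear and constant in \<open>t / \<sigma>\<close>, which is harmless
  asymptotically.\<close>

lemma (in prob_space) normal_tail_ge:
  assumes X: "distributed M lborel X (normal_density 0 \<sigma>)" and "\<sigma> > 0" "t \<ge> 0"
  shows "exp (- (t / \<sigma> + 1)\<^sup>2 / 2) / sqrt (2 * pi) \<le> prob {\<omega> \<in> space M. t \<le> X \<omega>}"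
proof -
  let ?c = "exp (- (t / \<sigma> + 1)\<^sup>2 / 2) / sqrt (2 * pi) / \<sigma>"
  have dens: "?c \<le> normal_density 0 \<sigma> x" if "x \<in> {t..t + \<sigma>}" for x
  proof -
    have "x / \<sigma> \<le> t / \<sigma> + 1" "0 \<le> x / \<sigma>"
      using that assms by (auto simp: field_simps)
    then have "(x / \<sigma>)\<^sup>2 \<le> (t / \<sigma> + 1)\<^sup>2"
      by (intro power_mono)
    then have "x\<^sup>2 / (2 * \<sigma>\<^sup>2) \<le> (t / \<sigma> + 1)\<^sup>2 / 2"
      by (simp add: power_divide)
    then have "exp (- (t / \<sigma> + 1)\<^sup>2 / 2) \<le> exp (- x\<^sup>2 / (2 * \<sigma>\<^sup>2))"
      by simp
    moreover have "sqrt (2 * pi * \<sigma>\<^sup>2) = sqrt (2 * pi) * \<sigma>"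
      using \<open>\<sigma> > 0\<close> by (simp add: real_sqrt_mult)
    ultimately show ?thesis
      using \<open>\<sigma> > 0\<close> by (simp add: normal_density_def divide_simps)
  qed
  have "ennreal (?c * \<sigma>) = (\<integral>\<^sup>+x. ennreal ?c * indicator {t..t + \<sigma>} x \<partial>lborel)"
    using \<open>\<sigma> > 0\<close> by (subst nn_integral_cmult_indicator) (auto simp: ennreal_mult[symmetric])
  also have "\<dots> \<le> (\<integral>\<^sup>+x. ennreal (normal_density 0 \<sigma> x) * indicator {t..} x \<partial>lborel)"
    using dens by (intro nn_integral_mono) (auto split: split_indicator intro!: ennreal_leI)
  also have "\<dots> = emeasure M (X -` {t..} \<inter> space M)"
    by (subst distributed_emeasure[OF X]) auto
  also have "X -` {t..} \<inter> space M = {\<omega> \<in> space M. t \<le> X \<omega>}"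
    by auto
  finally show ?thesis
    using \<open>\<sigma> > 0\<close> by (simp add: emeasure_eq_measure)
qed

section \<open>Weights of the noise in the average\<close>

text \<open>The term \<open>c j\<close> enters every partial sum with \<open>j < k \<le> N\<close>,
  hence \<open>N - j\<close> times. In the induction step all weights grow by one; the new index
  \<open>N\<close> starts from weight 0.\<close>

lemma sum_partial_sums:
  fixes c :: "nat \<Rightarrow> real"
  shows "(\<Sum>k=0..N. \<Sum>j<k. c j) = (\<Sum>j<N. real (N - j) * c j)"
proof (induction N)
  case (Suc N)
  have "(\<Sum>j<Suc N. real (Suc N - j) * c j) = (\<Sum>j<Suc N. real (N - j) * c j + c j)"
    by (intro sum.cong) (auto simp: Suc_diff_le algebra_simps)
  then show ?case
    using Suc by (simp add: sum.distrib)
qed simp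

lemma sum_countdown: "(\<Sum>j<N. real (N - j)) = real N * (real N + 1) / 2"
proof -
  \<comment> \<open>Reversing the order of summation removes the truncated subtraction before the
    induction.\<close>
  have "(\<Sum>j<N. real (N - j)) = (\<Sum>j<N. real (Suc j))"
    using sum.nat_diff_reindex[of "\<lambda>j. real (Suc j)" N] by (simp add: Suc_diff_Suc)
  also have "\<dots> = real N * (real N + 1) / 2"
    by (induction N) (auto simp: field_simps)
  finally show ?thesis .
qed

lemma sum_countdown_squares:
  "(\<Sum>j<N. (real (N - j))\<^sup>2) = real N * (real N + 1) * (2 * real N + 1) / 6"
proof -
  have "(\<Sum>j<N. (real (N - j))\<^sup>2) = (\<Sum>j<N. (real (Suc j))\<^sup>2)"
    using sum.nat_diff_reindex[of "\<lambda>j. (real (Suc j))\<^sup>2" N] by (simp add: Suc_diff_Suc)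
  also have "\<dots> = real N * (real N + 1) * (2 * real N + 1) / 6"
    by (induction N) (auto simp: field_simps power2_eq_square)
  finally show ?thesis .
qed

section \<open>Pathwise comparison and measurability\<close>

text \<open>The bound on \<open>g\<close> is uniform in the position, so each step with the same
  noise descends at most as far as a step with slope \<open>a\<close>. Induction compares the paths,
  and \<open>sum_partial_sums\<close> averages the comparison path.\<close>

lemma averaged_iterate_ge:
  assumes "\<And>x. g x \<le> a" "\<eta> \<ge> 0"
  shows "x0 - \<eta> / real (N + 1) * (\<Sum>j<N. real (N - j) * (a + e j))
    \<le> averaged_iterate N (\<lambda>_. \<eta>) g x0 e"
proof -
  have iter: "x0 - \<eta> * (\<Sum>j<k. a + e j) \<le> iterate (\<lambda>_. \<eta>) g x0 e k" for k
  proof (induction k)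
    case (Suc k)
    have "\<eta> * g (iterate (\<lambda>_. \<eta>) g x0 e k) \<le> \<eta> * a"
      using assms by (intro mult_left_mono)
    with Suc show ?case
      by (simp add: algebra_simps)
  qed simp
  let ?S = "\<Sum>j<N. real (N - j) * (a + e j)"
  have "real (N + 1) * x0 - \<eta> * ?S = (\<Sum>k=0..N. x0 - \<eta> * (\<Sum>j<k. a + e j))"
    by (simp only: sum_subtractf sum_distrib_left[symmetric] sum_partial_sums) simp
  also have "\<dots> \<le> (\<Sum>k=0..N. iterate (\<lambda>_. \<eta>) g x0 e k)"
    by (intro sum_mono iter)
  finally have "(real (N + 1) * x0 - \<eta> * ?S) / real (N + 1)
      \<le> (\<Sum>k=0..N. iterate (\<lambda>_. \<eta>) g x0 e k) / real (N + 1)"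
    by (intro divide_right_mono) auto
  then show ?thesis
    by (simp add: averaged_iterate_def diff_divide_distrib del: of_nat_add of_nat_Suc)
qed

text \<open>Makes the failure event measurable, as monotonicity of the probability requires. The
  noise is controlled only below index \<open>N\<close>, so the induction stops at
  \<open>k \<le> N\<close>; iterate \<open>N\<close> still uses only \<open>e 0\<close> to
  \<open>e (N - 1)\<close>.\<close>

lemma averaged_iterate_measurable:
  assumes "\<And>k. k < N \<Longrightarrow> e k \<in> borel_measurable M" and [measurable]: "g \<in> borel_measurable borel"
  shows "(\<lambda>\<omega>. averaged_iterate N hs g x0 (\<lambda>k. e k \<omega>)) \<in> borel_measurable M"
proof -
  have "(\<lambda>\<omega>. iterate hs g x0 (\<lambda>k. e k \<omega>) k) \<in> borel_measurable M" if "k \<le> N" for k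
    using that
  proof (induction k)
    case (Suc k)
    then have [measurable]: "(\<lambda>\<omega>. iterate hs g x0 (\<lambda>k. e k \<omega>) k) \<in> borel_measurable M"
      "e k \<in> borel_measurable M"
      using assms(1) by auto
    show ?case by simp
  qed simp
  then show ?thesis
    unfolding averaged_iterate_def by (intro borel_measurable_times borel_measurable_sum) auto
qed

section \<open>The hard instance\<close>

context
  fixes a L R x0 :: real
  assumes a: "0 < a" "a \<le> L" and R: "R > 0"
begin

lemma abs_minimizer: "is_minimizer (\<lambda>x. a * \<bar>x - x0\<bar>) x0"
  using a by (auto simp: is_arg_min_def not_less)

lemma abs_in_convex_class: "(\<lambda>x. a * \<bar>x - x0\<bar>) \<in> convex_class x0 R L"
proof -
  have "convex_on UNIV (\<lambda>x. a * dist x0 x)"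
    using a by (intro convex_on_cmul convex_on_dist) auto
  moreover have "\<bar>v\<bar> \<le> L" if "v \<in> subdifferential (\<lambda>x. a * \<bar>x - x0\<bar>) x" for v x
  proof -
    have ineq: "a * \<bar>x - x0\<bar> + v * (y - x) \<le> a * \<bar>y - x0\<bar>" for y
      using that by (auto simp: subdifferential_def)
    \<comment> \<open>A unit step changes the function by at most \<open>a\<close>; testing the
      subgradient inequality at \<open>x + 1\<close> and \<open>x - 1\<close> therefore gives
      \<open>\<bar>v\<bar> \<le> a \<le> L\<close>.\<close>
    have "a * \<bar>x + d - x0\<bar> \<le> a * (\<bar>x - x0\<bar> + \<bar>d\<bar>)" for d
      using a by (intro mult_left_mono) auto
    from ineq[of "x + 1"] ineq[of "x - 1"] this[of 1] this[of "-1"] show ?thesis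
      using a by (simp add: algebra_simps)
  qed
  ultimately show ?thesis
    using abs_minimizer R by (auto simp: convex_class_def dist_real_def abs_minus_commute)
qed

lemma abs_subgradient_selection:
  "subgradient_selection (\<lambda>x. a * \<bar>x - x0\<bar>) (\<lambda>x. if x0 \<le> x then a else - a)"
proof -
  have "a * \<bar>x - x0\<bar> + (if x0 \<le> x then a else - a) * (y - x) \<le> a * \<bar>y - x0\<bar>" for x y
  proof -
    have "a * (y - x0) \<le> a * \<bar>y - x0\<bar>" "a * (x0 - y) \<le> a * \<bar>y - x0\<bar>"
      using a by (auto intro!: mult_left_mono)
    then show ?thesis by (auto simp: algebra_simps abs_if)
  qed
  then show ?thesis
    by (auto simp: subgradient_selection_def subdifferential_def)
qed

end

section \<open>Failure probability of the instance\<close>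

lemma iid_gaussian_weighted_sum:
  assumes iid: "iid_gaussian M N s e" and "s > 0" "N > 0" and w: "\<And>j. j < N \<Longrightarrow> w j \<noteq> 0"
  shows "distributed M lborel (\<lambda>\<omega>. \<Sum>j<N. w j * e j \<omega>)
    (normal_density 0 (s * sqrt (\<Sum>j<N. (w j)\<^sup>2)))"
proof -
  interpret prob_space M
    using iid by (simp add: iid_gaussian_def)
  have "indep_vars (\<lambda>_. borel) e {..<N}"
    using iid by (simp add: iid_gaussian_def)
  then have indep: "indep_vars (\<lambda>_. borel) (\<lambda>j \<omega>. w j * e j \<omega>) {..<N}"
    by (rule indep_vars_compose2) measurable
  have normal: "distributed M lborel (\<lambda>\<omega>. w j * e j \<omega>) (normal_density 0 (\<bar>w j\<bar> * s))"
    if "j \<in> {..<N}" for j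
  proof -
    have "distributed M lborel (e j) (normal_density 0 s)"
      using iid that by (simp add: iid_gaussian_def)
    from normal_density_affine[OF this \<open>s > 0\<close>, of "w j" 0] w that show ?thesis
      by simp
  qed
  have "distributed M lborel (\<lambda>\<omega>. \<Sum>j<N. w j * e j \<omega>)
    (normal_density (\<Sum>j<N. 0) (sqrt (\<Sum>j<N. (\<bar>w j\<bar> * s)\<^sup>2)))"
    \<comment> \<open>Nonzero weights keep every summand nondegenerate, and \<open>N > 0\<close>
      makes the index set nonempty.\<close>
    by (rule sum_indep_normal[OF _ _ indep _ normal]) (use w \<open>s > 0\<close> \<open>N > 0\<close> in auto)
  moreover have "sqrt (\<Sum>j<N. (\<bar>w j\<bar> * s)\<^sup>2) = s * sqrt (\<Sum>j<N. (w j)\<^sup>2)"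
    using \<open>s > 0\<close> by (simp add: power_mult_distrib sum_distrib_right[symmetric] real_sqrt_mult)
  ultimately show ?thesis
    by simp
qed

text \<open>With step size \<open>\<eta> = h / sqrt (N + 1)\<close>, the noise has to offset the
  drift \<open>\<eta> * a * N / 2\<close> of the average and add a displacement
  \<open>eps / a\<close>. Their sum is smallest when they are equal; replacing \<open>N\<close> by
  \<open>N + 1\<close> in that balance gives the stated \<open>a\<^sup>2\<close>. The threshold for
  the weighted noise is then at most \<open>a * (N + 1)\<^sup>2\<close>, and \<open>\<sigma>\<close>
  is the standard deviation of that noise.\<close>

lemma failure_prob_ge:
  fixes a :: real
  assumes iid: "iid_gaussian M N s e" and "s > 0" "N > 0" "R > 0" "h > 0" "eps > 0"
    and a: "0 < a" "a \<le> L" "a\<^sup>2 = 2 * eps / (h * sqrt (real (N + 1)))"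
  defines "\<sigma> \<equiv> s * sqrt (real N * (real N + 1) * (2 * real N + 1) / 6)"
  shows "\<exists>p \<in> failure_probs M e N (constant_schedule h N) x0 R L eps.
    exp (- (a * (real N + 1)\<^sup>2 / \<sigma> + 1)\<^sup>2 / 2) / sqrt (2 * pi) \<le> p"
proof -
  interpret prob_space M
    using iid by (simp add: iid_gaussian_def)
  define \<eta> where "\<eta> = h / sqrt (real (N + 1))"
  define f where "f x = a * \<bar>x - x0\<bar>" for x
  define g where "g x = (if x0 \<le> x then a else - a)" for x
  define xA where "xA \<omega> = averaged_iterate N (\<lambda>_. \<eta>) g x0 (\<lambda>k. e k \<omega>)" for \<omega>
  \<comment> \<open>The method subtracts the noise, so negated noise pushes the average
    upwards.\<close>
  define Z where "Z \<omega> = (\<Sum>j<N. - real (N - j) * e j \<omega>)" for \<omega>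
  have "\<eta> > 0" and sched: "constant_schedule h N = (\<lambda>_. \<eta>)"
    using \<open>h > 0\<close> by (auto simp: \<eta>_def constant_schedule_def)
  have "h * sqrt (real (N + 1)) = \<eta> * (real N + 1)"
    by (simp add: \<eta>_def field_simps)
  moreover have "\<eta> * (real N + 1) > 0"
    using \<open>\<eta> > 0\<close> by (intro mult_pos_pos) linarith+
  ultimately have a2: "a\<^sup>2 * (\<eta> * (real N + 1)) = 2 * eps"
    using a(3) by (metis nonzero_eq_divide_eq less_irrefl)
  have "e k \<in> borel_measurable M" if "k < N" for k
    using iid that by (auto simp: iid_gaussian_def distributed_def)
  moreover have "g \<in> borel_measurable borel"
    unfolding g_def by measurable
  ultimately have [measurable]: "xA \<in> borel_measurable M"
    unfolding xA_def by (intro averaged_iterate_measurable)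
  have f_instance: "f \<in> convex_class x0 R L" "is_minimizer f x0" "subgradient_selection f g"
    unfolding f_def[abs_def] g_def[abs_def]
    using a(1,2) \<open>R > 0\<close> abs_in_convex_class abs_minimizer abs_subgradient_selection by auto
  have implies_fail: "eps \<le> f (xA \<omega>) - f x0" if "a * (real N + 1)\<^sup>2 \<le> Z \<omega>" for \<omega>
  proof -
    have "(\<Sum>j<N. real (N - j) * (a + e j \<omega>)) = a * (real N * (real N + 1) / 2) - Z \<omega>"
      unfolding Z_def sum_countdown[symmetric]
      by (simp only: distrib_left sum.distrib sum_distrib_left mult.commute[of a] mult_minus_left
          sum_negf diff_minus_eq_add)
    also have "\<dots> \<le> a * (real N * (real N + 1) / 2) - a * (real N + 1)\<^sup>2"
      using that by simp
    \<comment> \<open>At most half of the threshold pays for the drift; the remaining half yields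
      the displacement.\<close>
    also have "\<dots> \<le> - (a * (real N + 1)\<^sup>2 / 2)"
    proof -
      have "a * (real N * (real N + 1)) \<le> a * (real N + 1)\<^sup>2"
        using a(1) by (intro mult_left_mono) (auto simp: power2_eq_square algebra_simps)
      then show ?thesis
        by (simp only: times_divide_eq_right)
    qed
    finally have "\<eta> / real (N + 1) * (\<Sum>j<N. real (N - j) * (a + e j \<omega>))
        \<le> \<eta> / real (N + 1) * - (a * (real N + 1)\<^sup>2 / 2)"
      using \<open>\<eta> > 0\<close> by (intro mult_left_mono) auto
    moreover have "\<dots> = - (\<eta> * a * (real N + 1) / 2)"
      by (simp add: field_simps power2_eq_square)
    moreover have "x0 - \<eta> / real (N + 1) * (\<Sum>j<N. real (N - j) * (a + e j \<omega>)) \<le> xA \<omega>"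
      unfolding xA_def using a(1) \<open>\<eta> > 0\<close> by (intro averaged_iterate_ge) (auto simp: g_def)
    ultimately have "\<eta> * a * (real N + 1) / 2 \<le> \<bar>xA \<omega> - x0\<bar>"
      by linarith
    \<comment> \<open>By \<open>a2\<close> the left-hand side is exactly \<open>eps\<close>.\<close>
    then have "a * (\<eta> * a * (real N + 1) / 2) \<le> a * \<bar>xA \<omega> - x0\<bar>"
      using a(1) by (intro mult_left_mono) auto
    then show ?thesis
      using a2 by (simp add: f_def power2_eq_square algebra_simps)
  qed
  have "exp (- (a * (real N + 1)\<^sup>2 / \<sigma> + 1)\<^sup>2 / 2) / sqrt (2 * pi)
      \<le> prob {\<omega> \<in> space M. a * (real N + 1)\<^sup>2 \<le> Z \<omega>}"
  proof (rule normal_tail_ge)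
    show "distributed M lborel Z (normal_density 0 \<sigma>)"
      using iid_gaussian_weighted_sum[OF iid \<open>s > 0\<close> \<open>N > 0\<close>, of "\<lambda>j. - real (N - j)"]
      by (simp add: Z_def[abs_def] \<sigma>_def sum_countdown_squares[symmetric] del: of_nat_diff)
    show "\<sigma> > 0"
      using \<open>s > 0\<close> \<open>N > 0\<close> by (simp add: \<sigma>_def add_pos_pos)
    show "0 \<le> a * (real N + 1)\<^sup>2"
      using a(1) by (intro mult_nonneg_nonneg) auto
  qed
  also have "\<dots> \<le> prob {\<omega> \<in> space M. eps \<le> f (xA \<omega>) - f x0}"
    unfolding f_def by (rule finite_measure_mono) (use implies_fail in \<open>auto simp: f_def\<close>)
  also have "prob {\<omega> \<in> space M. eps \<le> f (xA \<omega>) - f x0}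
      \<in> failure_probs M e N (constant_schedule h N) x0 R L eps"
    unfolding failure_probs_def sched xA_def
    using f_instance by (intro CollectI exI[of _ f] exI[of _ g] exI[of _ x0]) simp
  finally (rev_bexI[rotated]) show ?thesis .
qed

section \<open>Asymptotics of the exponent\<close>

text \<open>The fraction under the root behaves like \<open>sqrt (N + 1) / 2\<close>, so half the
  square is \<open>3 * c * sqrt (N + 1)\<close> to leading order. The cross term is of order
  \<open>(N + 1) powr (1/4)\<close> and the rest is constant; all of this fits below the factor
  4.\<close>

lemma gaussian_exponent_rate:
  fixes c C :: real
  assumes "c > 0"
  shows "\<forall>\<^sub>F N in sequentially.
    (sqrt (12 * c * ((real N + 1) ^ 3 / (sqrt (real N + 1) * real N * (2 * real N + 1)))) + 1)\<^sup>2 / 2 + C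
      \<le> 4 * c * sqrt (real N + 1)"
proof -
  define r where "r N = sqrt ((real N + 1) ^ 3 / (sqrt (real N + 1) * real N * (2 * real N + 1)))"
    for N :: nat
  define k where "k = sqrt (12 * c)"
  have k2: "k\<^sup>2 = 12 * c"
    using assms by (simp add: k_def)
  have "(\<lambda>N. (real N + 1) ^ 3 / (sqrt (real N + 1) * real N * (2 * real N + 1)) / sqrt (real N + 1))
      \<longlonglongrightarrow> 1 / 2"
    by real_asymp
  then have "(\<lambda>N. (r N)\<^sup>2 / sqrt (real N + 1)) \<longlonglongrightarrow> 1 / 2"
    by (simp add: r_def)
  moreover have "(\<lambda>N. r N / sqrt (real N + 1)) \<longlonglongrightarrow> 0"
    "(\<lambda>N. 1 / sqrt (real N + 1)) \<longlonglongrightarrow> 0"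
    unfolding r_def by (real_asymp, real_asymp)
  ultimately have "(\<lambda>N. k\<^sup>2 / 2 * ((r N)\<^sup>2 / sqrt (real N + 1)) + k * (r N / sqrt (real N + 1))
      + (1 / 2 + C) * (1 / sqrt (real N + 1))) \<longlonglongrightarrow> k\<^sup>2 / 2 * (1 / 2) + k * 0 + (1 / 2 + C) * 0"
    by (intro tendsto_add tendsto_mult tendsto_const)
  \<comment> \<open>The limit equals \<open>3 * c\<close>; this strict gap turns convergence into an
    eventual inequality.\<close>
  moreover have "k\<^sup>2 / 2 * (1 / 2) + k * 0 + (1 / 2 + C) * 0 < 4 * c"
    using assms by (simp add: k2)
  ultimately have "\<forall>\<^sub>F N in sequentially. k\<^sup>2 / 2 * ((r N)\<^sup>2 / sqrt (real N + 1))
      + k * (r N / sqrt (real N + 1)) + (1 / 2 + C) * (1 / sqrt (real N + 1)) < 4 * c"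
    by (rule order_tendstoD)
  then show ?thesis
  proof eventually_elim
    case (elim N)
    have "0 < sqrt (real N + 1)"
      by (simp add: add_nonneg_pos)
    moreover have "k\<^sup>2 / 2 * ((r N)\<^sup>2 / sqrt (real N + 1)) + k * (r N / sqrt (real N + 1))
        + (1 / 2 + C) * (1 / sqrt (real N + 1)) = ((k * r N + 1)\<^sup>2 / 2 + C) / sqrt (real N + 1)"
      by (simp add: power2_eq_square algebra_simps add_divide_distrib)
    ultimately have "(k * r N + 1)\<^sup>2 / 2 + C < 4 * c * sqrt (real N + 1)"
      using elim by (simp add: pos_divide_less_eq)
    then show ?case
      by (simp only: k_def r_def real_sqrt_mult[symmetric] less_imp_le)
  qed
qed

text \<open>One failure probability bounded below by \<open>q > 0\<close> keeps the supremum away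
  from 0, where \<open>neg_log\<close> is infinite. Boundedness by 1 ensures that the real
  \<open>Sup\<close> dominates its elements.\<close>

lemma error_exponent_le:
  assumes "prob_space M" "p \<in> failure_probs M e N hs x0 R L eps" "0 < q" "q \<le> p"
  shows "error_exponent M e N hs x0 R L eps \<le> ereal (- ln q)"
proof -
  interpret prob_space M by fact
  have "bdd_above (failure_probs M e N hs x0 R L eps)"
    by (rule bdd_aboveI[of _ 1]) (auto simp: failure_probs_def)
  then have "q \<le> Sup (failure_probs M e N hs x0 R L eps)"
    using assms by (meson cSup_upper order_trans)
  then show ?thesis
    using \<open>0 < q\<close> by (auto simp: error_exponent_def neg_log_def)
qed

theorem lemma1:
  fixes x0 R L s eps h :: real
    and M :: "nat \<Rightarrow> 'a measure"
    and e :: "nat \<Rightarrow> nat \<Rightarrow> 'a \<Rightarrow> real"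
  assumes "R > 0" and "L > 0" and "s > 0" and "h > 0"
    and "0 < eps" and "eps < R * L"
    and "\<And>N. iid_gaussian (M N) N s (e N)"
  shows "\<exists>\<delta> :: nat \<Rightarrow> real. \<delta> \<in> o(\<lambda>_. 1) \<and>
    (\<forall>\<^sub>F N in sequentially.
       error_exponent (M N) (e N) N (constant_schedule h N) x0 R L eps
         \<le> ereal (4 * eps * sqrt (real (N + 1)) / (h * s\<^sup>2) * (1 + \<delta> N)))"
proof (intro exI[of _ "\<lambda>_. 0"] conjI)
  define a where "a N = sqrt (2 * eps / (h * sqrt (real N + 1)))" for N :: nat
  define \<sigma> where "\<sigma> N = s * sqrt (real N * (real N + 1) * (2 * real N + 1) / 6)" for N :: nat
  define q where "q N = exp (- (a N * (real N + 1)\<^sup>2 / \<sigma> N + 1)\<^sup>2 / 2) / sqrt (2 * pi)" for N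
  have "(\<lambda>N. 2 * eps / (h * sqrt (real N + 1))) \<longlonglongrightarrow> 0"
    using \<open>h > 0\<close> \<open>0 < eps\<close> by real_asymp
  then have "a \<longlonglongrightarrow> 0"
    unfolding a_def using tendsto_real_sqrt by force
  \<comment> \<open>The slope vanishes as \<open>N\<close> grows, so the instance eventually lies in
    the class for the fixed \<open>L\<close>.\<close>
  then have small: "\<forall>\<^sub>F N in sequentially. a N < L"
    using \<open>L > 0\<close> by (rule order_tendstoD)
  have c_pos: "eps / (h * s\<^sup>2) > 0"
    using assms by simp
  have rate: "\<forall>\<^sub>F N in sequentially.
      (a N * (real N + 1)\<^sup>2 / \<sigma> N + 1)\<^sup>2 / 2 + ln (sqrt (2 * pi))
        \<le> 4 * eps * sqrt (real N + 1) / (h * s\<^sup>2)"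
    \<comment> \<open>Here \<open>c = eps / (h * s\<^sup>2)\<close>, and \<open>C\<close> is the
      logarithm of the normalizing factor in \<open>q\<close>.\<close>
    using gaussian_exponent_rate[OF c_pos, of "ln (sqrt (2 * pi))"] eventually_gt_at_top[of 0]
  proof eventually_elim
    case (elim N)
    have "a N * (real N + 1)\<^sup>2 / \<sigma> N \<ge> 0"
      using assms by (simp add: a_def \<sigma>_def)
    \<comment> \<open>The constant 12 is the 2 from \<open>a\<^sup>2\<close> times the 6 from the
      sum of squares; \<open>N > 0\<close> keeps \<open>\<sigma> N\<close> nonzero.\<close>
    moreover have "(a N * (real N + 1)\<^sup>2 / \<sigma> N)\<^sup>2
        = 12 * (eps / (h * s\<^sup>2)) * ((real N + 1) ^ 3 / (sqrt (real N + 1) * real N * (2 * real N + 1)))"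
      using assms elim(2)
      by (simp add: a_def \<sigma>_def divide_simps)
        (simp add: eval_nat_numeral)
    ultimately have "a N * (real N + 1)\<^sup>2 / \<sigma> N = sqrt (12 * (eps / (h * s\<^sup>2)) *
        ((real N + 1) ^ 3 / (sqrt (real N + 1) * real N * (2 * real N + 1))))"
      by (metis real_sqrt_unique)
    with elim(1) assms show ?case
      by (simp add: mult.assoc)
  qed
  show "\<forall>\<^sub>F N in sequentially.
      error_exponent (M N) (e N) N (constant_schedule h N) x0 R L eps
        \<le> ereal (4 * eps * sqrt (real (N + 1)) / (h * s\<^sup>2) * (1 + 0))"
    using small rate eventually_gt_at_top[of 0]
  proof eventually_elim
    case (elim N)
    have "a N > 0" "(a N)\<^sup>2 = 2 * eps / (h * sqrt (real (N + 1)))"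
      using \<open>h > 0\<close> \<open>0 < eps\<close> by (auto simp: a_def add.commute)
    with elim obtain p where p: "p \<in> failure_probs (M N) (e N) N (constant_schedule h N) x0 R L eps"
      "q N \<le> p"
      using failure_prob_ge[of "M N" N s "e N" R h eps "a N" L x0] assms
      unfolding q_def \<sigma>_def by auto
    have "prob_space (M N)"
      using assms(7) by (simp add: iid_gaussian_def)
    then have "error_exponent (M N) (e N) N (constant_schedule h N) x0 R L eps \<le> ereal (- ln (q N))"
      using p by (intro error_exponent_le) (auto simp: q_def)
    also have "- ln (q N) = (a N * (real N + 1)\<^sup>2 / \<sigma> N + 1)\<^sup>2 / 2 + ln (sqrt (2 * pi))"
      by (simp add: q_def ln_div)
    finally show ?case
      using elim(2) by (simp add: add.commute order_trans)
  qed
qed simp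

end
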